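(* Let $F\in\mathbb F_{I,E}(\beta,L)$ for a partition $I=(I_1,\dots,I_{|I|})\in\mathcal I$, $E\in\mathcal E_\eta$, with component smoothness indices $\beta_i$, and let $g$ satisfy Assumption G with $\ell=\max_i\lfloor\beta_i\rfloor$. Then for $\theta=(I,E,h)$ with $h=(h_1,\dots,h_d)\in[h_{\min},h_{\max}]^d$, $0<h_{\min}\le h_{\max}$, $$\|B_\theta\|_\infty\le L\sum_{i=1}^{|I|}\|g\|_1^{|I_i|}\sum_{j\in I_i}h_j^{\beta_i}.$$
   Context: $d\ge1$, $\mathcal D_0=[-1/2,1/2]^d$. Hölder ball $\mathbb H_s(\beta,L)$: functions $f:\mathbb R^s\to\mathbb R$ with continuous partial derivatives of all orders $\le l$, where $\beta=l+\alpha$, $l$ a nonnegative integer, $\alpha\in(0,1]$, such that $\|D^{\mathbf k}f\|_\infty\le L$ for $|\mathbf k|\le l$ and $|f(z)-\sum_{|\mathbf k|\le l}\frac{D^{\mathbf k}f(t)}{\mathbf k!}(z-t)^{\mathbf k}|\le L|z-t|^\beta$ for all $z,t$. $\mathcal I$ is the set of partitions of $\{1,\dots,d\}$; for fixed $\eta>0$, $\mathcal E_\eta=\{E=(e_1,\dots,e_d):e_i\in\mathbb S^{d-1},|\det E|\ge\eta\}$; $E_i$ is the matrix of columns $e_j$, $j\in I_i$. $\mathbb F_{I,E}(\beta,L)$ is the set of $F$ with $F(t)=\sum_{i=1}^{|I|}f_i(E_i^Tt)$, $f_i\in\mathbb H_{|I_i|}(\beta_i,L)$, $\beta=\beta_i/|I_i|$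 for all $i$. Assumption G: $g:[-1/2,1/2]\to\mathbb R$, $\int g=1$, $\int g(x)x^kdx=0$ for $k=1,\dots,\ell$, $g\in C^1$. $G_0(t)=\prod_{i=1}^dg(t_i)$, $G_{i,h}(t)=\prod_{j\in I_i}h_j^{-1}g(t_j/h_j)\prod_{j\notin I_i}g(t_j)$, $K_\theta(t)=|\det E|\sum_{i=1}^{|I|}G_{i,h}(E^Tt)-(|I|-1)|\det E|G_0(E^Tt)$. The bias is $B_\theta(x)=\int K_\theta(t-x)F(t)dt-F(x)$, $x\in\mathcal D_0$, and $\|\cdot\|_\infty$ is the sup over $\mathcal D_0$. *)

theory Defs
  imports "HOL-Analysis.Analysis"
begin

text \<open>The ambient space R^d is real^'n with d = CARD('n). A component f_i of
 a partition block A (a subset of coordinates, |A| = s) is a function on R^d that is only ever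
 evaluated on (and only constrained on) the coordinate subspace Vsub A, which is a copy of R^s.\<close>

definition Vsub :: "'n::finite set \<Rightarrow> (real^'n) set" where
  "Vsub A = {x. \<forall>j. j \<notin> A \<longrightarrow> x $ j = 0}"

definition pdir :: "'n::finite \<Rightarrow> (real^'n \<Rightarrow> real) \<Rightarrow> real^'n \<Rightarrow> real" where
  "pdir j f x = deriv (\<lambda>s. f (x + s *\<^sub>R axis j 1)) 0"

fun pds :: "'n::finite list \<Rightarrow> (real^'n \<Rightarrow> real) \<Rightarrow> real^'n \<Rightarrow> real" where
  "pds [] f = f"
| "pds (j # js) f = pdir j (pds js f)"

definition enum_idx :: "'n::finite list" where
  "enum_idx = (SOME xs. distinct xs \<and> set xs = UNIV)"

text \<open>Partial derivative D^k f for a multi-index k.\<close>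
definition Dmulti :: "('n::finite \<Rightarrow> nat) \<Rightarrow> (real^'n \<Rightarrow> real) \<Rightarrow> real^'n \<Rightarrow> real" where
  "Dmulti k f = pds (concat (map (\<lambda>j. replicate (k j) j) enum_idx)) f"

definition multi_idx :: "'n::finite set \<Rightarrow> nat \<Rightarrow> ('n \<Rightarrow> nat) set" where
  "multi_idx A l = {k. (\<forall>j. j \<notin> A \<longrightarrow> k j = 0) \<and> sum k UNIV \<le> l}"

text \<open>Hoelder ball H_s(beta,L), s = |A|, with beta = l + alpha, alpha in (0,1].\<close>
definition holder_ball :: "'n::finite set \<Rightarrow> real \<Rightarrow> real \<Rightarrow> (real^'n \<Rightarrow> real) \<Rightarrow> bool" where
  "holder_ball A \<beta> L f \<longleftrightarrow> \<beta> > 0 \<and>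
     (let l = nat (\<lceil>\<beta>\<rceil> - 1) in
       (\<forall>js. set js \<subseteq> A \<and> length js < l \<longrightarrow>
          (\<forall>j\<in>A. \<forall>x\<in>Vsub A. (\<lambda>s. pds js f (x + s *\<^sub>R axis j 1)) differentiable (at 0))) \<and>
       (\<forall>js. set js \<subseteq> A \<and> length js \<le> l \<longrightarrow> continuous_on (Vsub A) (pds js f)) \<and>
       (\<forall>k\<in>multi_idx A l. \<forall>x\<in>Vsub A. \<bar>Dmulti k f x\<bar> \<le> L) \<and>
       (\<forall>z\<in>Vsub A. \<forall>t\<in>Vsub A.
          \<bar>f z - (\<Sum>k\<in>multi_idx A l. Dmulti k f t / (\<Prod>j\<in>UNIV. fact (k j))
                    * (\<Prod>j\<in>UNIV. (z $ j - t $ j) ^ k j))\<bar> \<le> L * norm (z - t) powr \<beta>))"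

text \<open>Projection E_A^T t, placed in the coordinate subspace Vsub A.\<close>
definition projE :: "'n::finite set \<Rightarrow> real^'n^'n \<Rightarrow> real^'n \<Rightarrow> real^'n" where
  "projE A E t = (\<chi> j. if j \<in> A then (transpose E *v t) $ j else 0)"

text \<open>Assumption G; g is given on [-1/2,1/2] and extended by 0 outside.\<close>
definition assumption_G :: "(real \<Rightarrow> real) \<Rightarrow> nat \<Rightarrow> bool" where
  "assumption_G g ell \<longleftrightarrow>
     (\<forall>x. x \<notin> {-1/2..1/2} \<longrightarrow> g x = 0) \<and>
     integral {-1/2..1/2} g = 1 \<and>
     (\<forall>k\<in>{1..ell}. integral {-1/2..1/2} (\<lambda>x. g x * x ^ k) = 0) \<and>
     (\<exists>g'. continuous_on {-1/2..1/2} g' \<and>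
        (\<forall>x\<in>{-1/2..1/2}. (g has_real_derivative g' x) (at x within {-1/2..1/2})))"

definition l1norm :: "(real \<Rightarrow> real) \<Rightarrow> real" where
  "l1norm g = integral {-1/2..1/2} (\<lambda>x. \<bar>g x\<bar>)"

definition G0 :: "(real \<Rightarrow> real) \<Rightarrow> real^'n::finite \<Rightarrow> real" where
  "G0 g u = (\<Prod>j\<in>UNIV. g (u $ j))"

definition Gih :: "(real \<Rightarrow> real) \<Rightarrow> 'n::finite set \<Rightarrow> ('n \<Rightarrow> real) \<Rightarrow> real^'n \<Rightarrow> real" where
  "Gih g A h u = (\<Prod>j\<in>A. g (u $ j / h j) / h j) * (\<Prod>j\<in>UNIV - A. g (u $ j))"

definition Ktheta :: "(real \<Rightarrow> real) \<Rightarrow> 'n::finite set set \<Rightarrow> real^'n^'n \<Rightarrow> ('n \<Rightarrow> real) \<Rightarrow> real^'n \<Rightarrow> real" where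
  "Ktheta g P E h t =
     \<bar>det E\<bar> * (\<Sum>A\<in>P. Gih g A h (transpose E *v t))
     - (real (card P) - 1) * \<bar>det E\<bar> * G0 g (transpose E *v t)"

definition bias :: "(real \<Rightarrow> real) \<Rightarrow> 'n::finite set set \<Rightarrow> real^'n^'n \<Rightarrow> ('n \<Rightarrow> real)
     \<Rightarrow> (real^'n \<Rightarrow> real) \<Rightarrow> real^'n \<Rightarrow> real" where
  "bias g P E h F x = integral UNIV (\<lambda>t. Ktheta g P E h (t - x) * F t) - F x"

definition D0 :: "(real^'n::finite) set" where
  "D0 = {x. \<forall>j. \<bar>x $ j\<bar> \<le> 1/2}"

end

theory Submission
  imports Defs
begin

text \<open>After the substitution u = E^T t the kernel K_theta(t - x) becomes
  sum_A G_{A,h}(u - y) - (|I| - 1) G_0(u - y) with y = E^T x, a combination of tensor-product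
  kernels, while the summand f_B(E_B^T t) of F depends only on the coordinates u_j, j in B.
  Coordinates on which the integrand does not depend integrate out against kernel factors of unit
  mass, so for A \<noteq> B the kernel G_{A,h} acts on f_B exactly like G_0, and these |I| - 1 terms
  cancel the correction term. What remains is f_B smoothed by the rescaled kernel in each
  coordinate j in B. Taken one coordinate at a time, each step reproduces the Taylor polynomial
  of f_B exactly (the moments of g vanish up to order floor(beta_B)), so it moves the value by at
  most ||g||_1 L h_j^beta_B, the Hoelder remainder; the mass ||g||_1^|B| of the kernels already
  applied bounds the accumulation.\<close>

subsection \<open>Linear change of variables on \<open>real^'n\<close>\<close>

text \<open>The change-of-variables theorems of the library require a wellordered index type, so a
  finite index type is transported to a copy of itself ordered by \<open>to_nat\<close>.\<close>

typedef 'a wo = "UNIV :: 'a set" morphisms rep_wo Abs_wo by auto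

instantiation wo :: (countable) linorder
begin
definition "less_eq_wo (x::'a::countable wo) (y::'a wo) \<longleftrightarrow> to_nat (rep_wo x) \<le> to_nat (rep_wo y)"
definition "less_wo (x::'a::countable wo) (y::'a wo) \<longleftrightarrow> to_nat (rep_wo x) < to_nat (rep_wo y)"
instance by standard (auto simp: less_eq_wo_def less_wo_def rep_wo_inject)
end

instance wo :: (countable) wellorder
proof
  fix P :: "'a wo \<Rightarrow> bool" and a :: "'a wo"
  assume H: "\<And>x. (\<And>y. y < x \<Longrightarrow> P y) \<Longrightarrow> P x"
  have "\<forall>x. to_nat (rep_wo x) = n \<longrightarrow> P x" for n
    by (induction n rule: less_induct) (metis H less_wo_def)
  then show "P a" by blast
qed

instance wo :: (finite) finite
proof
  have "(UNIV :: 'a wo set) = range Abs_wo" by (metis UNIV_eq_I Abs_wo_cases image_eqI)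
  moreover have "finite (range (Abs_wo :: 'a \<Rightarrow> 'a wo))" by (rule finite_imageI) simp
  ultimately show "finite (UNIV :: 'a wo set)" by simp
qed

lemma rep_wo_Abs_wo [simp]: "rep_wo (Abs_wo x) = x"
  by (simp add: Abs_wo_inverse)

lemma bij_rep_wo: "bij rep_wo"
proof (rule bijI)
  show "inj rep_wo" by (meson injI rep_wo_inject)
  show "surj rep_wo" by (metis surj_def rep_wo_Abs_wo)
qed

lemma prod_UNIV_rep_wo: "(\<Prod>k\<in>UNIV. f k) = (\<Prod>i\<in>UNIV. f (rep_wo i))"
  using prod.reindex_bij_betw[OF bij_rep_wo, of f] by simp

lemma sum_UNIV_rep_wo: "(\<Sum>k\<in>UNIV. f k) = (\<Sum>i\<in>UNIV. f (rep_wo i))"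
  using sum.reindex_bij_betw[OF bij_rep_wo, of f] by simp

definition wo_mat :: "real^'n::finite^'n \<Rightarrow> real^('n wo)^('n wo)" where
  "wo_mat A = (\<chi> p q. A $ rep_wo p $ rep_wo q)"

definition wo_vec :: "real^('n::finite wo) \<Rightarrow> real^'n" where
  "wo_vec y = (\<chi> j. y $ Abs_wo j)"

lemma sign_conj_rep_wo:
  fixes p :: "'n::finite wo \<Rightarrow> 'n wo"
  assumes "p permutes UNIV"
  shows "sign (rep_wo \<circ> p \<circ> Abs_wo) = sign p"
proof -
  interpret permutes_bij_finite p UNIV UNIV rep_wo Abs_wo
    "\<lambda>x. if x \<in> UNIV then rep_wo (p (Abs_wo x)) else x"
    using assms bij_rep_wo by unfold_locales (auto simp: rep_wo_inverse)
  have "(\<lambda>x. if x \<in> UNIV then rep_wo (p (Abs_wo x)) else x) = rep_wo \<circ> p \<circ> Abs_wo" by auto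
  then show ?thesis using sign_p' by simp
qed

lemma det_wo_mat: "det (wo_mat A) = det A"
  unfolding det_def
proof (rule sum.reindex_bij_witness[where j = "\<lambda>p. rep_wo \<circ> p \<circ> Abs_wo" and i = "\<lambda>q. Abs_wo \<circ> q \<circ> rep_wo"])
  fix p :: "'a wo \<Rightarrow> 'a wo" assume p: "p \<in> {p. p permutes UNIV}"
  show "Abs_wo \<circ> (rep_wo \<circ> p \<circ> Abs_wo) \<circ> rep_wo = p" by (auto simp: fun_eq_iff rep_wo_inverse)
  show "rep_wo \<circ> p \<circ> Abs_wo \<in> {p. p permutes UNIV}"
    using p unfolding mem_Collect_eq permutes_univ by (metis comp_apply rep_wo_Abs_wo rep_wo_inverse)
  have "(\<Prod>i\<in>UNIV. A $ i $ (rep_wo \<circ> p \<circ> Abs_wo) i)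
      = (\<Prod>i\<in>UNIV. A $ rep_wo i $ (rep_wo \<circ> p \<circ> Abs_wo) (rep_wo i))"
    by (rule prod_UNIV_rep_wo)
  then show "of_int (sign (rep_wo \<circ> p \<circ> Abs_wo)) * (\<Prod>i\<in>UNIV. A $ i $ (rep_wo \<circ> p \<circ> Abs_wo) i) =
         of_int (sign p) * (\<Prod>i\<in>UNIV. wo_mat A $ i $ p i)"
    using p by (simp add: sign_conj_rep_wo wo_mat_def rep_wo_inverse)
next
  fix q :: "'a \<Rightarrow> 'a" assume q: "q \<in> {p. p permutes UNIV}"
  show "rep_wo \<circ> (Abs_wo \<circ> q \<circ> rep_wo) \<circ> Abs_wo = q" by (auto simp: fun_eq_iff)
  show "Abs_wo \<circ> q \<circ> rep_wo \<in> {p. p permutes UNIV}"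
    using q unfolding mem_Collect_eq permutes_univ by (metis comp_apply rep_wo_Abs_wo rep_wo_inverse)
qed

lemma matrix_vector_mult_wo_vec: "A *v wo_vec y = wo_vec (wo_mat A *v y)"
  unfolding wo_vec_def wo_mat_def
  by (simp add: vec_eq_iff matrix_vector_mult_def rep_wo_inverse
      sum_UNIV_rep_wo[where f="\<lambda>k. A $ _ $ k * y $ Abs_wo k"])

lemma wo_vec_measurable [measurable]: "wo_vec \<in> borel_measurable borel"
  unfolding wo_vec_def by (intro borel_measurable_continuous_onI continuous_intros)

lemma prod_Basis_vec: "(\<Prod>b\<in>(Basis :: (real^'n::finite) set). x \<bullet> b) = (\<Prod>i\<in>UNIV. x $ i)"
  by (simp add: Basis_vec_def cart_eq_inner_axis axis_eq_axis prod.UNION_disjoint)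

lemma Basis_le_vec: "(\<forall>b\<in>(Basis :: (real^'n::finite) set). l \<bullet> b \<le> u \<bullet> b) \<longleftrightarrow> (\<forall>i. l $ i \<le> u $ i)"
  by (auto simp: Basis_vec_def cart_eq_inner_axis)

lemma distr_lborel_wo_vec: "distr lborel borel wo_vec = (lborel :: (real^'n::finite) measure)"
proof (rule lborel_eqI[symmetric])
  fix l u :: "real^'n" assume "\<And>b. b \<in> Basis \<Longrightarrow> l \<bullet> b \<le> u \<bullet> b"
  then have le: "\<forall>i. l $ i \<le> u $ i" using Basis_le_vec by blast
  define rep where "rep x = (\<chi> i. x $ rep_wo i)" for x :: "real^'n"
  have "wo_vec -` box l u \<inter> space lborel = box (rep l) (rep u)"
    by (auto simp: mem_box_cart wo_vec_def rep_def) (metis rep_wo_Abs_wo rep_wo_inverse)+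
  then have "emeasure (distr lborel borel wo_vec) (box l u) = emeasure lborel (box (rep l) (rep u))"
    by (simp add: emeasure_distr)
  also have "\<dots> = (\<Prod>i\<in>UNIV. u $ rep_wo i - l $ rep_wo i)"
    using le by (simp add: emeasure_lborel_box_eq Basis_le_vec prod_Basis_vec rep_def)
  also have "\<dots> = (\<Prod>b\<in>Basis. (u - l) \<bullet> b)"
    using prod_UNIV_rep_wo[of "\<lambda>i. u $ i - l $ i"] by (simp add: prod_Basis_vec)
  finally show "emeasure (distr lborel borel wo_vec) (box l u) = (\<Prod>b\<in>Basis. (u - l) \<bullet> b)" .
qed simp

lemma lborel_integral_matrix_image_wellorder:
  fixes A :: "real^'m::{finite,wellorder}^'m::_" and f :: "real^'m::_ \<Rightarrow> real"
  assumes "det A \<noteq> 0" and f: "integrable lborel f"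
  shows "integrable lborel (\<lambda>x. f (A *v x))"
    and "\<bar>det A\<bar> * (\<integral>x. f (A *v x) \<partial>lborel) = (\<integral>x. f x \<partial>lborel)"
proof -
  obtain B where AB: "A ** B = mat 1" "B ** A = mat 1"
    using assms(1) invertible_det_nz invertible_def by blast
  have [measurable]: "f \<in> borel_measurable borel" using f by auto
  have "(\<lambda>x. \<bar>det (matrix ((*v) A))\<bar> * f (A *v x)) absolutely_integrable_on UNIV \<and>
           integral UNIV (\<lambda>x. \<bar>det (matrix ((*v) A))\<bar> * f (A *v x)) = integral UNIV f \<longleftrightarrow>
         f absolutely_integrable_on UNIV \<and> integral UNIV f = integral UNIV f"
    apply (rule cov_invertible_real[where h="(*v) B" and h'="\<lambda>_. (*v) B"])
    using AB by (auto simp: linear_imp_has_derivative matrix_vector_mul_assoc o_def fun_eq_iff)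
  moreover have "f absolutely_integrable_on UNIV"
    using f by (simp add: set_integrable_def integrable_completion)
  ultimately have *: "(\<lambda>x. \<bar>det A\<bar> * f (A *v x)) absolutely_integrable_on UNIV"
      "integral UNIV (\<lambda>x. \<bar>det A\<bar> * f (A *v x)) = integral UNIV f"
    by auto
  have "(\<lambda>x. f (A *v x)) \<in> borel_measurable borel"
    by (intro measurable_compose[OF borel_measurable_continuous_onI[OF linear_continuous_on[OF
        matrix_vector_mul_bounded_linear]]]) auto
  then have "integrable lborel (\<lambda>x. \<bar>det A\<bar> * f (A *v x))"
    using *(1) by (simp add: set_integrable_def integrable_completion)
  then show i: "integrable lborel (\<lambda>x. f (A *v x))"
    using assms(1) by (simp add: integrable_mult_left_iff)
  show "\<bar>det A\<bar> * (\<integral>x. f (A *v x) \<partial>lborel) = (\<integral>x. f x \<partial>lborel)"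
    using *(2) i f by (simp add: integral_lborel)
qed

lemma has_integral_matrix_image:
  fixes A :: "real^'n::finite^'n" and f :: "real^'n \<Rightarrow> real"
  assumes "det A \<noteq> 0" and "has_bochner_integral lborel f I"
  shows "((\<lambda>x. \<bar>det A\<bar> * f (A *v x)) has_integral I) UNIV"
proof -
  have f: "integrable lborel f" and I: "I = (\<integral>x. f x \<partial>lborel)"
    using assms(2) by (auto simp: has_bochner_integral_iff)
  have [measurable]: "f \<in> borel_measurable borel" using f by auto
  have transfer: "integrable lborel \<phi> \<longleftrightarrow> integrable lborel (\<lambda>y. \<phi> (wo_vec y))"
      "(\<integral>x. \<phi> x \<partial>lborel) = (\<integral>y. \<phi> (wo_vec y) \<partial>lborel)"
    if [measurable]: "\<phi> \<in> borel_measurable borel" for \<phi> :: "real^'n \<Rightarrow> real"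
    by (subst distr_lborel_wo_vec[symmetric], simp add: integrable_distr_eq integral_distr)+
  have fA [measurable]: "(\<lambda>x. f (A *v x)) \<in> borel_measurable borel"
    by (intro measurable_compose[OF borel_measurable_continuous_onI[OF linear_continuous_on[OF
        matrix_vector_mul_bounded_linear]]]) auto
  have dA: "det (wo_mat A) \<noteq> 0" using assms(1) by (simp add: det_wo_mat)
  have fwo: "integrable lborel (\<lambda>y. f (wo_vec y))" using f transfer(1)[of f] by simp
  note cov = lborel_integral_matrix_image_wellorder[OF dA fwo]
  have fAi: "integrable lborel (\<lambda>x. f (A *v x))"
    using cov(1) transfer(1)[OF fA] by (simp add: matrix_vector_mult_wo_vec)
  have "\<bar>det A\<bar> * (\<integral>x. f (A *v x) \<partial>lborel) = I"
    using cov(2) transfer(2)[OF fA] transfer(2)[of f] I by (simp add: matrix_vector_mult_wo_vec det_wo_mat)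
  then show ?thesis
    using has_integral_integral_lborel[of "\<lambda>x. \<bar>det A\<bar> * f (A *v x)"] fAi by simp
qed

subsection \<open>Lebesgue measure on \<open>real^'n\<close> as a product measure\<close>

definition coord_vec :: "'n::finite set \<Rightarrow> ('n \<Rightarrow> real) \<Rightarrow> real^'n" where
  "coord_vec S x = (\<Sum>j\<in>S. x j *\<^sub>R axis j 1)"

lemma coord_vec_nth [simp]: "coord_vec S x $ i = (if i \<in> S then x i else 0)"
  by (simp add: coord_vec_def sum_component axis_def if_distrib[where f="\<lambda>z. _ * z"] cong: if_cong)

lemma coord_vec_measurable [measurable]:
  "coord_vec S \<in> borel_measurable (Pi\<^sub>M S (\<lambda>_::'n::finite. lborel))"
  unfolding coord_vec_def
  by (rule borel_measurable_sum) (auto intro!: borel_measurable_scaleR measurable_component_singleton)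

lemma coord_vec_insert:
  "i \<notin> S \<Longrightarrow> coord_vec (insert i S) (x(i:=y)) = coord_vec S x + y *\<^sub>R axis i 1"
  by (auto simp: vec_eq_iff axis_def)

lemma norm_coord_vec_le:
  fixes S :: "'n::finite set" and x :: "'n \<Rightarrow> real" and c :: real
  assumes "c \<ge> 0" and "\<And>j. j \<in> S \<Longrightarrow> \<bar>x j\<bar> \<le> c"
  shows "norm (coord_vec S x) \<le> CARD('n) * c"
proof -
  have "norm (coord_vec S x) \<le> (\<Sum>j\<in>S. norm (x j *\<^sub>R axis j (1::real)))"
    unfolding coord_vec_def by (rule norm_sum)
  also have "\<dots> \<le> real (card S) * c" using sum_bounded_above[of S "\<lambda>j. \<bar>x j\<bar>" c] assms(2) by simp
  also have "\<dots> \<le> CARD('n) * c" using assms(1) by (intro mult_right_mono) (simp_all add: card_mono)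
  finally show ?thesis .
qed

interpretation lborel_product: product_sigma_finite "\<lambda>_. lborel"
  by (simp add: product_sigma_finite_def lborel.sigma_finite_measure_axioms)

lemma distr_PiM_coord_vec:
  "distr (Pi\<^sub>M UNIV (\<lambda>_::'n::finite. lborel)) borel (coord_vec UNIV) = (lborel :: (real^'n) measure)"
proof (rule lborel_eqI[symmetric])
  fix l u :: "real^'n" assume "\<And>b. b \<in> Basis \<Longrightarrow> l \<bullet> b \<le> u \<bullet> b"
  then have le: "\<forall>i. l $ i \<le> u $ i" using Basis_le_vec by blast
  have "coord_vec UNIV -` box l u \<inter> space (Pi\<^sub>M UNIV (\<lambda>_::'n. lborel)) = (\<Pi>\<^sub>E j\<in>UNIV. {l$j<..<u$j})"
    by (auto simp: mem_box_cart space_PiM PiE_def Pi_def extensional_def)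
  then have "emeasure (distr (Pi\<^sub>M UNIV (\<lambda>_. lborel)) borel (coord_vec UNIV)) (box l u)
      = emeasure (Pi\<^sub>M UNIV (\<lambda>_::'n. lborel)) (\<Pi>\<^sub>E j\<in>UNIV. {l$j<..<u$j})"
    by (simp add: emeasure_distr)
  also have "\<dots> = (\<Prod>i\<in>UNIV. emeasure lborel {l$i<..<u$i})"
    by (rule lborel_product.emeasure_PiM) auto
  also have "\<dots> = ennreal (\<Prod>i\<in>UNIV. (u - l) $ i)"
    using le by (simp add: prod_ennreal)
  finally show "emeasure (distr (Pi\<^sub>M UNIV (\<lambda>_. lborel)) borel (coord_vec UNIV)) (box l u)
      = (\<Prod>b\<in>Basis. (u - l) \<bullet> b)"
    by (simp add: prod_Basis_vec)
qed simp

subsection \<open>Bounds for Bochner integrals\<close>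

lemma abs_integral_bound:
  fixes f b :: "'a \<Rightarrow> real"
  assumes "integrable M b" "\<And>x. x \<in> space M \<Longrightarrow> \<bar>f x\<bar> \<le> b x"
  shows "\<bar>\<integral>x. f x \<partial>M\<bar> \<le> (\<integral>x. b x \<partial>M)"
proof -
  have "\<bar>\<integral>x. f x \<partial>M\<bar> \<le> (\<integral>x. \<bar>f x\<bar> \<partial>M)"
    using integral_norm_bound[of M f] by simp
  also have "\<dots> \<le> (\<integral>x. b x \<partial>M)"
    using assms by (intro integral_mono') (auto intro: order_trans[OF abs_ge_zero])
  finally show ?thesis .
qed

lemma integrable_mult_bounded_on_support:
  fixes w \<phi> :: "'a \<Rightarrow> real"
  assumes "integrable M w" "\<phi> \<in> borel_measurable M"
    and "\<And>x. x \<in> space M \<Longrightarrow> w x \<noteq> 0 \<Longrightarrow> \<bar>\<phi> x\<bar> \<le> C"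
  shows "integrable M (\<lambda>x. w x * \<phi> x)"
proof (rule Bochner_Integration.integrable_bound[where f="\<lambda>x. C * w x"])
  show "integrable M (\<lambda>x. C * w x)" using assms(1) by simp
  show "(\<lambda>x. w x * \<phi> x) \<in> borel_measurable M"
    using assms(1,2) by (intro borel_measurable_times) auto
  show "AE x in M. norm (w x * \<phi> x) \<le> norm (C * w x)"
  proof (rule AE_I2)
    fix x assume x: "x \<in> space M"
    show "norm (w x * \<phi> x) \<le> norm (C * w x)"
    proof (cases "w x = 0")
      case False
      then have "\<bar>\<phi> x\<bar> \<le> \<bar>C\<bar>" using assms(3) x by fastforce
      then have "\<bar>w x\<bar> * \<bar>\<phi> x\<bar> \<le> \<bar>w x\<bar> * \<bar>C\<bar>" by (intro mult_left_mono) auto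
      then show ?thesis by (simp add: abs_mult mult.commute)
    qed simp
  qed
qed

lemma (in product_sigma_finite) product_integrable_insert:
  fixes f :: "_ \<Rightarrow> real"
  assumes I: "finite I" "i \<notin> I" and f: "integrable (Pi\<^sub>M (insert i I) M) f"
  shows "integrable (Pi\<^sub>M I M) (\<lambda>x. \<integral>y. f (x(i:=y)) \<partial>M i)"
proof -
  interpret I: finite_product_sigma_finite M I by standard fact
  interpret i: finite_product_sigma_finite M "{i}" by standard simp
  interpret P: pair_sigma_finite "Pi\<^sub>M I M" "Pi\<^sub>M {i} M" ..
  have ins: "insert i I = I \<union> {i}" by auto
  have f_borel: "f \<in> borel_measurable (Pi\<^sub>M (insert i I) M)" by (rule borel_measurable_integrable[OF f])
  have fint: "integrable (Pi\<^sub>M I M \<Otimes>\<^sub>M Pi\<^sub>M {i} M) (\<lambda>x. f (merge I {i} x))"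
  proof (rule integrable_distr[OF measurable_merge])
    have d: "distr (Pi\<^sub>M I M \<Otimes>\<^sub>M Pi\<^sub>M {i} M) (Pi\<^sub>M (I \<union> {i}) M) (merge I {i}) = Pi\<^sub>M (I \<union> {i}) M"
      by (rule distr_merge) (use I in auto)
    have f': "integrable (Pi\<^sub>M (I \<union> {i}) M) f" using f unfolding ins .
    show "integrable (distr (Pi\<^sub>M I M \<Otimes>\<^sub>M Pi\<^sub>M {i} M) (Pi\<^sub>M (I \<union> {i}) M) (merge I {i})) f"
      by (simp only: d f')
  qed
  then have intf: "integrable (Pi\<^sub>M I M) (\<lambda>x. \<integral>y. f (merge I {i} (x, y)) \<partial>Pi\<^sub>M {i} M)"
    by (rule P.integrable_fst')
  have eqx: "(\<integral>y. f (merge I {i} (x, y)) \<partial>Pi\<^sub>M {i} M) = (\<integral>y. f (x(i:=y)) \<partial>M i)"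
    if x: "x \<in> space (Pi\<^sub>M I M)" for x
  proof -
    have m: "(\<lambda>y. f (x(i := y))) \<in> borel_measurable (M i)"
      using measurable_comp[OF measurable_component_update f_borel, OF x \<open>i \<notin> I\<close>]
      unfolding comp_def .
    have "(\<integral>y. f (merge I {i} (x, y)) \<partial>Pi\<^sub>M {i} M) = (\<integral>y. f (x(i := y i)) \<partial>Pi\<^sub>M {i} M)"
    proof (rule Bochner_Integration.integral_cong[OF refl])
      fix y assume y: "y \<in> space (Pi\<^sub>M {i} M)"
      have "merge I {i} (x, y) = x(i := y i)"
      proof
        fix ia show "merge I {i} (x, y) ia = (x(i := y i)) ia"
          using x y I by (cases "ia \<in> I"; cases "ia = i") (auto simp: merge_def space_PiM PiE_def extensional_def)
      qed
      then show "f (merge I {i} (x, y)) = f (x(i := y i))" by simp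
    qed
    also have "\<dots> = (\<integral>y. f (x(i:=y)) \<partial>M i)"
      by (rule product_integral_singleton[OF m])
    finally show ?thesis .
  qed
  show ?thesis using iffD1[OF Bochner_Integration.integrable_cong[OF refl eqx] intf] .
qed

subsection \<open>Smoothing by a product kernel in a set of coordinates\<close>

definition supported_kernels :: "real \<Rightarrow> ('n \<Rightarrow> real \<Rightarrow> real) \<Rightarrow> bool" where
  "supported_kernels c w \<longleftrightarrow> c \<ge> 0 \<and> (\<forall>j. integrable lborel (w j) \<and> (\<forall>s. c < \<bar>s\<bar> \<longrightarrow> w j s = 0))"

definition smoothing ::
  "'n::finite set \<Rightarrow> ('n \<Rightarrow> real \<Rightarrow> real) \<Rightarrow> (real^'n \<Rightarrow> real) \<Rightarrow> real^'n \<Rightarrow> real" where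
  "smoothing S w Q z = (\<integral>x. (\<Prod>j\<in>S. w j (x j)) * Q (z + coord_vec S x) \<partial>Pi\<^sub>M S (\<lambda>_. lborel))"

lemma smoothing_integrable:
  fixes S :: "'n::finite set"
  assumes w: "supported_kernels c w" and Q: "continuous_on UNIV Q"
  shows "integrable (Pi\<^sub>M S (\<lambda>_. lborel)) (\<lambda>x. (\<Prod>j\<in>S. w j (x j)) * Q (z + coord_vec S x))"
proof -
  obtain C where C: "\<And>v. v \<in> cball z (CARD('n) * c) \<Longrightarrow> norm (Q v) \<le> C"
    using continuous_on_compact_bound[of "cball z (CARD('n) * c)" Q] Q
    by (metis compact_cball continuous_on_subset subset_UNIV)
  show ?thesis
  proof (rule integrable_mult_bounded_on_support[where C=C])
    show "integrable (Pi\<^sub>M S (\<lambda>_. lborel)) (\<lambda>x. \<Prod>j\<in>S. w j (x j))"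
      using w by (intro lborel_product.product_integrable_prod) (auto simp: supported_kernels_def)
    show "(\<lambda>x. Q (z + coord_vec S x)) \<in> borel_measurable (Pi\<^sub>M S (\<lambda>_. lborel))"
      using borel_measurable_continuous_onI[OF Q] by measurable
    fix x assume "(\<Prod>j\<in>S. w j (x j)) \<noteq> 0"
    then have "\<And>j. j \<in> S \<Longrightarrow> \<bar>x j\<bar> \<le> c" using w by (force simp: supported_kernels_def)
    then have "norm (coord_vec S x) \<le> CARD('n) * c"
      using w by (intro norm_coord_vec_le) (auto simp: supported_kernels_def)
    then show "\<bar>Q (z + coord_vec S x)\<bar> \<le> C" using C by (simp add: dist_norm)
  qed
qed

lemma smoothing_empty: "smoothing ({} :: 'n::finite set) w Q z = Q z"
proof -
  have "(\<integral>x. 1 \<partial>Pi\<^sub>M ({} :: 'n set) (\<lambda>_. lborel :: real measure)) = (1::real)"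
    using lborel_product.product_integral_prod[of "{}" "\<lambda>_ _. 1::real"] by simp
  then have "(\<integral>x. 1 * Q z \<partial>Pi\<^sub>M ({} :: 'n set) (\<lambda>_. lborel :: real measure)) = Q z"
    by (simp only: integral_mult_left_zero)
  then show ?thesis by (simp add: smoothing_def coord_vec_def)
qed

lemma smoothing_insert:
  assumes w: "supported_kernels c w" and Q: "continuous_on UNIV Q" and i: "i \<notin> S"
  defines "Q' \<equiv> \<lambda>v. \<integral>s. w i s * Q (v + s *\<^sub>R axis i 1) \<partial>lborel"
  shows "smoothing (insert i S) w Q z = smoothing S w Q' z"
    and "integrable (Pi\<^sub>M S (\<lambda>_. lborel)) (\<lambda>x. (\<Prod>j\<in>S. w j (x j)) * Q' (z + coord_vec S x))"
proof -
  have fS: "finite S" by simp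
  note int = smoothing_integrable[OF w Q, of "insert i S" z]
  have "(\<Prod>j\<in>insert i S. w j ((x(i:=y)) j)) * Q (z + coord_vec (insert i S) (x(i:=y)))
      = (\<Prod>j\<in>S. w j (x j)) * (w i y * Q (z + coord_vec S x + y *\<^sub>R axis i 1))" for x y
  proof -
    have "(\<Prod>j\<in>S. w j ((x(i:=y)) j)) = (\<Prod>j\<in>S. w j (x j))" using i by (intro prod.cong) auto
    then show ?thesis using i by (simp add: coord_vec_insert add.assoc mult_ac)
  qed
  then have eq: "(\<integral>y. (\<Prod>j\<in>insert i S. w j ((x(i:=y)) j)) * Q (z + coord_vec (insert i S) (x(i:=y))) \<partial>lborel)
       = (\<Prod>j\<in>S. w j (x j)) * Q' (z + coord_vec S x)" for x
    by (simp only: Q'_def integral_mult_right_zero)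
  show "smoothing (insert i S) w Q z = smoothing S w Q' z"
    unfolding smoothing_def lborel_product.product_integral_insert[OF fS i int] eq by simp
  show "integrable (Pi\<^sub>M S (\<lambda>_. lborel)) (\<lambda>x. (\<Prod>j\<in>S. w j (x j)) * Q' (z + coord_vec S x))"
    using lborel_product.product_integrable_insert[OF fS i int] unfolding eq by simp
qed

lemma smoothing_cong:
  "(\<And>j. j \<in> S \<Longrightarrow> w j = w' j) \<Longrightarrow> smoothing S w Q z = smoothing S w' Q z"
  unfolding smoothing_def
  by (intro Bochner_Integration.integral_cong refl arg_cong2[where f="(*)"] prod.cong) auto

lemma smoothing_invariant_directions:
  assumes w: "supported_kernels c w" and Q: "continuous_on UNIV Q" and T: "T \<inter> S = {}"
    and w1: "\<And>i. i \<in> T \<Longrightarrow> (\<integral>s. w i s \<partial>lborel) = 1"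
    and inv: "\<And>i v s. i \<in> T \<Longrightarrow> Q (v + s *\<^sub>R axis i 1) = Q v"
  shows "smoothing (S \<union> T) w Q z = smoothing S w Q z"
proof -
  have "finite T" by simp
  then show ?thesis using T w1 inv
  proof (induction T rule: finite_induct)
    case (insert i T)
    have "(\<lambda>v. \<integral>s. w i s * Q (v + s *\<^sub>R axis i 1) \<partial>lborel) = Q"
      using insert.prems by (simp add: fun_eq_iff)
    then have "smoothing (insert i (S \<union> T)) w Q z = smoothing (S \<union> T) w Q z"
      using smoothing_insert(1)[OF w Q, of i "S \<union> T" z] insert by simp
    also have "\<dots> = smoothing S w Q z" by (rule insert.IH) (use insert in auto)
    finally show ?case by simp
  qed simp
qed

lemma smoothing_insert_bound:
  assumes w: "supported_kernels c w" and Q: "continuous_on UNIV Q" and i: "i \<notin> S"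
    and D: "\<And>v. \<bar>(\<integral>s. w i s * Q (v + s *\<^sub>R axis i 1) \<partial>lborel) - Q v\<bar> \<le> D"
  shows "\<bar>smoothing (insert i S) w Q z - smoothing S w Q z\<bar> \<le> (\<Prod>j\<in>S. \<integral>s. \<bar>w j s\<bar> \<partial>lborel) * D"
proof -
  define P where "P x = (\<Prod>j\<in>S. w j (x j))" for x
  define Q' where "Q' v = (\<integral>s. w i s * Q (v + s *\<^sub>R axis i 1) \<partial>lborel)" for v
  have iP: "integrable (Pi\<^sub>M S (\<lambda>_. lborel)) (\<lambda>x. (\<Prod>j\<in>S. \<bar>w j (x j)\<bar>))"
    using w by (intro lborel_product.product_integrable_prod) (auto simp: supported_kernels_def)
  have "smoothing (insert i S) w Q z - smoothing S w Q z
      = (\<integral>x. P x * Q' (z + coord_vec S x) - P x * Q (z + coord_vec S x) \<partial>Pi\<^sub>M S (\<lambda>_. lborel))"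
    using smoothing_insert[OF w Q i, of z] smoothing_integrable[OF w Q, of S z]
    by (simp add: smoothing_def P_def Q'_def)
  also have "\<bar>\<dots>\<bar> \<le> (\<integral>x. (\<Prod>j\<in>S. \<bar>w j (x j)\<bar>) * D \<partial>Pi\<^sub>M S (\<lambda>_. lborel))"
  proof (rule abs_integral_bound)
    show "integrable (Pi\<^sub>M S (\<lambda>_. lborel)) (\<lambda>x. (\<Prod>j\<in>S. \<bar>w j (x j)\<bar>) * D)"
      using iP by simp
    fix x
    have "\<bar>P x * Q' (z + coord_vec S x) - P x * Q (z + coord_vec S x)\<bar>
        = \<bar>P x\<bar> * \<bar>Q' (z + coord_vec S x) - Q (z + coord_vec S x)\<bar>"
      by (simp add: right_diff_distrib[symmetric] abs_mult)
    also have "\<dots> \<le> \<bar>P x\<bar> * D" using D unfolding Q'_def by (intro mult_left_mono) auto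
    finally show "\<bar>P x * Q' (z + coord_vec S x) - P x * Q (z + coord_vec S x)\<bar>
        \<le> (\<Prod>j\<in>S. \<bar>w j (x j)\<bar>) * D"
      by (simp add: P_def abs_prod)
  qed
  also have "\<dots> = (\<Prod>j\<in>S. \<integral>s. \<bar>w j s\<bar> \<partial>lborel) * D"
    using lborel_product.product_integral_prod[of S "\<lambda>j s. \<bar>w j s\<bar>"] w
    by (simp add: supported_kernels_def)
  finally show ?thesis .
qed

lemma smoothing_bound:
  assumes w: "supported_kernels c w" and Q: "continuous_on UNIV Q"
    and D: "\<And>i v. i \<in> S \<Longrightarrow> \<bar>(\<integral>s. w i s * Q (v + s *\<^sub>R axis i 1) \<partial>lborel) - Q v\<bar> \<le> N * e i"
    and N: "\<And>j. j \<in> S \<Longrightarrow> (\<integral>s. \<bar>w j s\<bar> \<partial>lborel) = N" and N1: "N \<ge> 1"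
    and e: "\<And>i. i \<in> S \<Longrightarrow> e i \<ge> 0"
  shows "\<bar>smoothing S w Q z - Q z\<bar> \<le> N ^ card S * (\<Sum>i\<in>S. e i)"
proof -
  have "finite S" by simp
  then show ?thesis using D N e
  proof (induction S rule: finite_induct)
    case (insert i S)
    have "\<bar>smoothing (insert i S) w Q z - smoothing S w Q z\<bar> \<le> N ^ card S * (N * e i)"
      using smoothing_insert_bound[OF w Q insert(2), of "N * e i" z] insert by simp
    moreover have "\<bar>smoothing S w Q z - Q z\<bar> \<le> N ^ card S * (\<Sum>i\<in>S. e i)"
      by (rule insert.IH) (use insert in auto)
    moreover have "N ^ card S * (\<Sum>i\<in>S. e i) \<le> N ^ Suc (card S) * (\<Sum>i\<in>S. e i)"
      using N1 insert.prems by (intro mult_right_mono power_increasing sum_nonneg) auto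
    ultimately show ?case using insert by (simp add: algebra_simps)
  qed (simp add: smoothing_empty)
qed

lemma vec_nth_measurable [measurable]: "(\<lambda>v::real^'n::finite. v $ j) \<in> borel_measurable borel"
  by (intro borel_measurable_continuous_onI continuous_intros)

lemma has_bochner_integral_product_kernel:
  fixes y :: "real^'n::finite"
  assumes w: "supported_kernels c w" and Q: "continuous_on UNIV Q"
  shows "has_bochner_integral lborel (\<lambda>v. (\<Prod>j\<in>UNIV. w j ((v - y) $ j)) * Q v)
           (smoothing UNIV w Q y)"
proof -
  define \<Psi> where "\<Psi> v = (\<Prod>j\<in>UNIV. w j ((v - y) $ j)) * Q v" for v
  have [measurable]: "w j \<in> borel_measurable borel" for j
    using w unfolding supported_kernels_def by (metis borel_measurable_integrable measurable_lborel2)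
  have [measurable]: "Q \<in> borel_measurable borel" using Q by (rule borel_measurable_continuous_onI)
  have \<Psi>m [measurable]: "\<Psi> \<in> borel_measurable borel" unfolding \<Psi>_def by measurable
  have \<Psi>y: "(\<lambda>x. \<Psi> (y + coord_vec UNIV x)) = (\<lambda>x. (\<Prod>j\<in>UNIV. w j (x j)) * Q (y + coord_vec UNIV x))"
    by (simp add: \<Psi>_def)
  have "has_bochner_integral (Pi\<^sub>M UNIV (\<lambda>_. lborel)) (\<lambda>x. \<Psi> (y + coord_vec UNIV x)) (smoothing UNIV w Q y)"
    unfolding \<Psi>y smoothing_def using smoothing_integrable[OF w Q] by (simp add: has_bochner_integral_iff)
  then have "has_bochner_integral lborel (\<lambda>u. \<Psi> (y + u)) (smoothing UNIV w Q y)"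
    by (subst distr_PiM_coord_vec[symmetric]) (simp add: has_bochner_integral_distr)
  then have "has_bochner_integral lborel \<Psi> (smoothing UNIV w Q y)"
    by (subst lborel_distr_plus[of y, symmetric]) (simp add: has_bochner_integral_distr)
  then show ?thesis by (simp only: \<Psi>_def[abs_def])
qed

subsection \<open>The kernel \<open>g\<close> and its rescalings\<close>

lemma has_bochner_integral_supported_half:
  fixes \<phi> :: "real \<Rightarrow> real"
  assumes "continuous_on {-1/2..1/2} \<phi>" and "\<And>x. x \<notin> {-1/2..1/2} \<Longrightarrow> \<phi> x = 0"
  shows "has_bochner_integral lborel \<phi> (integral {-1/2..1/2} \<phi>)"
proof -
  have "\<phi> x = indicator {-1/2..1/2} x *\<^sub>R \<phi> x" for x
    using assms(2)[of x] by (cases "x \<in> {-1/2..1/2}") auto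
  then have \<phi>: "\<phi> = (\<lambda>x. indicator {-1/2..1/2} x *\<^sub>R \<phi> x)" by blast
  have int: "integrable lborel \<phi>"
    by (subst \<phi>) (rule borel_integrable_compact[OF _ assms(1)], simp)
  have "(\<integral>x. \<phi> x \<partial>lborel) = integral UNIV \<phi>" using integral_lborel[OF int] by simp
  also have "\<dots> = integral UNIV (\<lambda>x. if x \<in> {-1/2..1/2} then \<phi> x else 0)"
    using assms(2) by (intro arg_cong[where f="integral UNIV"]) auto
  also have "\<dots> = integral {-1/2..1/2} \<phi>" by (rule integral_restrict_UNIV)
  finally show ?thesis using int by (simp add: has_bochner_integral_iff)
qed

lemma assumption_G_zero: "assumption_G g ell \<Longrightarrow> x \<notin> {-1/2..1/2} \<Longrightarrow> g x = 0"
  by (simp add: assumption_G_def)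

lemma assumption_G_continuous: "assumption_G g ell \<Longrightarrow> continuous_on {-1/2..1/2} g"
  unfolding assumption_G_def by (metis DERIV_continuous_on)

lemma assumption_G_integrals:
  assumes G: "assumption_G g ell"
  shows "k \<le> ell \<Longrightarrow> has_bochner_integral lborel (\<lambda>x. g x * x ^ k) (if k = 0 then 1 else 0)"
    and "has_bochner_integral lborel (\<lambda>x. \<bar>g x\<bar>) (l1norm g)"
proof -
  have hb: "has_bochner_integral lborel (\<lambda>x. g x * x ^ k) (integral {-1/2..1/2} (\<lambda>x. g x * x ^ k))"
    using assumption_G_continuous[OF G] assumption_G_zero[OF G]
    by (intro has_bochner_integral_supported_half continuous_intros) auto
  have I: "integral {-1/2..1/2} (\<lambda>x. g x * x ^ k) = (if k = 0 then 1 else 0)"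
    if "k \<le> ell" using G that by (auto simp: assumption_G_def)
  show "has_bochner_integral lborel (\<lambda>x. g x * x ^ k) (if k = 0 then 1 else 0)"
    if "k \<le> ell" using hb unfolding I[OF that] .
  show "has_bochner_integral lborel (\<lambda>x. \<bar>g x\<bar>) (l1norm g)"
    using assumption_G_continuous[OF G] assumption_G_zero[OF G] unfolding l1norm_def
    by (intro has_bochner_integral_supported_half continuous_intros) auto
qed

lemma one_le_l1norm:
  assumes G: "assumption_G g ell"
  shows "1 \<le> l1norm g"
proof -
  have "(\<integral>x. g x \<partial>lborel) = 1" using assumption_G_integrals(1)[OF G, of 0]
    by (simp add: has_bochner_integral_iff)
  moreover have "(\<integral>x. \<bar>g x\<bar> \<partial>lborel) = l1norm g" using assumption_G_integrals(2)[OF G]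
    by (simp add: has_bochner_integral_iff)
  ultimately show ?thesis using integral_norm_bound[of lborel g] by simp
qed

lemma has_bochner_integral_lborel_rescale:
  fixes \<psi> :: "real \<Rightarrow> real"
  assumes h: "0 < h" and \<psi>: "has_bochner_integral lborel \<psi> I"
  shows "has_bochner_integral lborel (\<lambda>s. \<psi> (s / h) / h) I"
proof -
  have e: "(\<lambda>x. \<psi> ((0 + h * x) / h) / h) = (\<lambda>x. \<psi> x / h)" using h by auto
  have "integrable lborel (\<lambda>x. \<psi> x / h)" using \<psi> by (simp add: has_bochner_integral_iff)
  moreover have "(\<integral>x. \<psi> x / h \<partial>lborel) * h = I" using \<psi> h by (simp add: has_bochner_integral_iff)
  ultimately show ?thesis
    using lborel_integrable_real_affine_iff[of h "\<lambda>s. \<psi> (s / h) / h" 0]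
      lborel_integral_real_affine[of h "\<lambda>s. \<psi> (s / h) / h" 0] h e
    by (simp add: has_bochner_integral_iff)
qed

definition scaled_kernel :: "(real \<Rightarrow> real) \<Rightarrow> real \<Rightarrow> real \<Rightarrow> real" where
  "scaled_kernel g h s = g (s / h) / h"

lemma scaled_kernel_eq_0:
  assumes "assumption_G g ell" "0 < h" "h / 2 < \<bar>s\<bar>"
  shows "scaled_kernel g h s = 0"
proof -
  have "s / h \<notin> {-1/2..1/2}" using assms(2,3) by (auto simp: field_simps abs_if split: if_splits)
  then show ?thesis using assumption_G_zero[OF assms(1)] by (simp add: scaled_kernel_def)
qed

lemma scaled_kernel_integrals:
  assumes G: "assumption_G g ell" and h: "0 < h"
  shows "k \<le> ell \<Longrightarrow>
      has_bochner_integral lborel (\<lambda>s. scaled_kernel g h s * s ^ k) (if k = 0 then 1 else 0)"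
    and "has_bochner_integral lborel (\<lambda>s. \<bar>scaled_kernel g h s\<bar>) (l1norm g)"
proof -
  have "has_bochner_integral lborel (\<lambda>s. h ^ k * (g (s / h) * (s / h) ^ k) / h)
      (h ^ k * (if k = 0 then 1 else 0))" if "k \<le> ell"
    using has_bochner_integral_lborel_rescale[OF h
        has_bochner_integral_mult_right[OF assumption_G_integrals(1)[OF G that]]] by simp
  moreover have "h ^ k * (g (s / h) * (s / h) ^ k) / h = scaled_kernel g h s * s ^ k" for s
    using h by (simp add: scaled_kernel_def power_divide)
  ultimately show "has_bochner_integral lborel (\<lambda>s. scaled_kernel g h s * s ^ k) (if k = 0 then 1 else 0)"
    if "k \<le> ell" using that by (cases "k = 0") simp_all
  have "\<bar>scaled_kernel g h s\<bar> = \<bar>g (s / h)\<bar> / h" for s using h by (simp add: scaled_kernel_def)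
  then show "has_bochner_integral lborel (\<lambda>s. \<bar>scaled_kernel g h s\<bar>) (l1norm g)"
    using has_bochner_integral_lborel_rescale[OF h assumption_G_integrals(2)[OF G]] by simp
qed

lemma integrable_scaled_kernel_mult:
  assumes G: "assumption_G g ell" and h: "0 < h" and \<phi>: "continuous_on UNIV \<phi>"
  shows "integrable lborel (\<lambda>s. scaled_kernel g h s * \<phi> s)"
proof -
  obtain C where C: "\<And>s. s \<in> {-h..h} \<Longrightarrow> norm (\<phi> s) \<le> C"
    using continuous_on_compact_bound[of "{-h..h}" \<phi>] \<phi>
    by (metis compact_Icc continuous_on_subset subset_UNIV)
  show ?thesis
  proof (rule integrable_mult_bounded_on_support[where C=C])
    show "integrable lborel (scaled_kernel g h)"
      using scaled_kernel_integrals(1)[OF G h, of 0] by (simp add: has_bochner_integral_iff)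
    fix s assume "scaled_kernel g h s \<noteq> 0"
    then have "\<bar>s\<bar> \<le> h / 2" using scaled_kernel_eq_0[OF G h, of s] by force
    then have "s \<in> {-h..h}" using h by auto
    then show "\<bar>\<phi> s\<bar> \<le> C" using C by simp
  qed (use \<phi> borel_measurable_continuous_onI in auto)
qed

subsection \<open>Hoelder functions on a coordinate subspace\<close>

definition projB :: "'n::finite set \<Rightarrow> real^'n \<Rightarrow> real^'n" where
  "projB B v = (\<chi> j. if j \<in> B then v $ j else 0)"

lemma projB_in_Vsub: "projB B v \<in> Vsub B"
  by (simp add: projB_def Vsub_def)

lemma projB_add_axis: "projB B (v + s *\<^sub>R axis i 1) = (if i \<in> B then projB B v + s *\<^sub>R axis i 1 else projB B v)"
  by (auto simp: projB_def vec_eq_iff axis_def)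

lemma continuous_on_projB: "continuous_on UNIV (projB B)"
  unfolding projB_def
proof (intro continuous_on_vec_lambda)
  show "continuous_on UNIV (\<lambda>x. if j \<in> B then x $ j else 0)" for j
    by (cases "j \<in> B") (auto intro: continuous_intros)
qed

lemma projE_eq_projB: "projE A E t = projB A (transpose E *v t)"
  by (simp only: projE_def projB_def)

lemma Dmulti_zero: "Dmulti (\<lambda>_. 0) f = f"
proof -
  have *: "\<And>xs. concat (map (\<lambda>j. []) xs) = []" by (induct_tac xs) auto
  show ?thesis by (simp add: Dmulti_def *)
qed

lemma finite_multi_idx: "finite (multi_idx A l)"
proof (rule finite_subset)
  show "multi_idx A l \<subseteq> (\<Pi>\<^sub>E i\<in>UNIV. {0..l})"
  proof
    fix k assume "k \<in> multi_idx A l"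
    then have "k i \<le> l" for i
      using member_le_sum[of i UNIV k] by (auto simp: multi_idx_def)
    then show "k \<in> (\<Pi>\<^sub>E i\<in>UNIV. {0..l})" by auto
  qed
qed (intro finite_PiE; simp)

lemma holder_ball_facts:
  assumes "holder_ball A \<beta> L f"
  shows holder_ball_pos: "\<beta> > 0"
    and holder_ball_continuous: "continuous_on (Vsub A) f"
    and holder_ball_L_nonneg: "L \<ge> 0"
    and holder_ball_taylor: "\<And>z t. z \<in> Vsub A \<Longrightarrow> t \<in> Vsub A \<Longrightarrow>
          \<bar>f z - (\<Sum>k\<in>multi_idx A (nat (\<lceil>\<beta>\<rceil> - 1)). Dmulti k f t / (\<Prod>j\<in>UNIV. fact (k j))
                    * (\<Prod>j\<in>UNIV. (z $ j - t $ j) ^ k j))\<bar> \<le> L * norm (z - t) powr \<beta>"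
proof -
  note h = assms[unfolded holder_ball_def Let_def]
  show "\<beta> > 0" using h by blast
  have "\<forall>js. set js \<subseteq> A \<and> length js \<le> nat (\<lceil>\<beta>\<rceil> - 1) \<longrightarrow> continuous_on (Vsub A) (pds js f)"
    using h by blast
  then have "continuous_on (Vsub A) (pds [] f)" by (metis empty_subsetI list.set(1) list.size(3) zero_le)
  then show "continuous_on (Vsub A) f" by simp
  have z0: "(\<lambda>_. 0) \<in> multi_idx A (nat (\<lceil>\<beta>\<rceil> - 1))" by (simp add: multi_idx_def)
  have "0 \<in> Vsub A" by (simp add: Vsub_def)
  then have "\<bar>Dmulti (\<lambda>_. 0) f 0\<bar> \<le> L" using h z0 by blast
  then show "L \<ge> 0" by linarith
  show "\<And>z t. z \<in> Vsub A \<Longrightarrow> t \<in> Vsub A \<Longrightarrow>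
          \<bar>f z - (\<Sum>k\<in>multi_idx A (nat (\<lceil>\<beta>\<rceil> - 1)). Dmulti k f t / (\<Prod>j\<in>UNIV. fact (k j))
                    * (\<Prod>j\<in>UNIV. (z $ j - t $ j) ^ k j))\<bar> \<le> L * norm (z - t) powr \<beta>"
    using h by blast
qed

lemma prod_axis_power:
  "(\<Prod>j\<in>UNIV. ((s *\<^sub>R axis i (1::real)) $ j) ^ k j) = (if \<forall>j. j \<noteq> i \<longrightarrow> k j = 0 then s ^ k i else 0)"
proof (cases "\<forall>j. j \<noteq> i \<longrightarrow> k j = 0")
  case True
  then have "(\<Prod>j\<in>UNIV. ((s *\<^sub>R axis i (1::real)) $ j) ^ k j) = (\<Prod>j\<in>UNIV. if j = i then s ^ k i else 1)"
    by (intro prod.cong) (auto simp: axis_def)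
  then show ?thesis using True by simp
next
  case False
  then obtain j where "j \<noteq> i" "k j \<noteq> 0" by auto
  then have "((s *\<^sub>R axis i (1::real)) $ j) ^ k j = 0" by (simp add: axis_def)
  then have "(\<Prod>j\<in>UNIV. ((s *\<^sub>R axis i (1::real)) $ j) ^ k j) = 0"
    using prod_zero[of UNIV "\<lambda>j. ((s *\<^sub>R axis i (1::real)) $ j) ^ k j"] by auto
  then show ?thesis by (subst if_not_P[OF False])
qed

lemma scaled_kernel_reproduces_polynomial:
  assumes G: "assumption_G g ell" and h: "0 < h" and M: "finite M" "(\<lambda>_. 0) \<in> M"
    and deg: "\<And>k. k \<in> M \<Longrightarrow> sum k UNIV \<le> ell"
  shows "has_bochner_integral lborel
    (\<lambda>s. scaled_kernel g h s * (\<Sum>k\<in>M. c k * (\<Prod>j\<in>UNIV. ((s *\<^sub>R axis i 1) $ j) ^ k j))) (c (\<lambda>_. 0))"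
proof -
  have summand: "has_bochner_integral lborel
      (\<lambda>s. c k * (scaled_kernel g h s * (\<Prod>j\<in>UNIV. ((s *\<^sub>R axis i 1) $ j) ^ k j)))
      (if k = (\<lambda>_. 0) then c k else 0)" if k: "k \<in> M" for k
  proof (cases "\<forall>j. j \<noteq> i \<longrightarrow> k j = 0")
    case True
    then have "k = (\<lambda>_. 0) \<longleftrightarrow> k i = 0" by (metis fun_eq_iff)
    moreover have "k i \<le> ell" using deg[OF k] member_le_sum[of i UNIV k] by simp
    ultimately show ?thesis
      using has_bochner_integral_mult_right[where c="c k", OF scaled_kernel_integrals(1)[OF G h, of "k i"]]
      unfolding prod_axis_power if_P[OF True] by (cases "k i = 0") simp_all
  next
    case False
    then have "k \<noteq> (\<lambda>_. 0)" by auto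
    then show ?thesis unfolding prod_axis_power if_not_P[OF False] by (simp add: has_bochner_integral_zero)
  qed
  have "has_bochner_integral lborel
      (\<lambda>s. \<Sum>k\<in>M. c k * (scaled_kernel g h s * (\<Prod>j\<in>UNIV. ((s *\<^sub>R axis i 1) $ j) ^ k j)))
      (\<Sum>k\<in>M. if k = (\<lambda>_. 0) then c k else 0)"
    using summand by (rule has_bochner_integral_sum)
  then show ?thesis using M by (simp add: sum_distrib_left mult.left_commute)
qed

lemma scaled_kernel_holder_step:
  assumes hol: "holder_ball B \<beta> L f" and i: "i \<in> B" and h: "0 < h"
    and G: "assumption_G g ell" and ell: "nat \<lfloor>\<beta>\<rfloor> \<le> ell"
  shows "\<bar>(\<integral>s. scaled_kernel g h s * f (projB B (v + s *\<^sub>R axis i 1)) \<partial>lborel) - f (projB B v)\<bar>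
           \<le> l1norm g * (L * h powr \<beta>)"
proof -
  define t where "t = projB B v"
  define z where "z s = t + s *\<^sub>R axis i 1" for s
  have tV: "t \<in> Vsub B" and zV: "z s \<in> Vsub B" for s
    using i by (auto simp: t_def z_def projB_def Vsub_def axis_def)
  have pz: "projB B (v + s *\<^sub>R axis i 1) = z s" for s by (simp add: z_def t_def projB_add_axis i)
  define l where "l = nat (\<lceil>\<beta>\<rceil> - 1)"
  define c where "c k = Dmulti k f t / (\<Prod>j\<in>UNIV. fact (k j))" for k
  define T where "T s = (\<Sum>k\<in>multi_idx B l. c k * (\<Prod>j\<in>UNIV. (z s $ j - t $ j) ^ k j))" for s
  have "\<lceil>\<beta>\<rceil> - 1 \<le> \<lfloor>\<beta>\<rfloor>" using ceiling_diff_floor_le_1[of \<beta>] by linarith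
  then have "l \<le> ell" using ell unfolding l_def by linarith
  then have "has_bochner_integral lborel (\<lambda>s. scaled_kernel g h s * T s) (f t)"
    using scaled_kernel_reproduces_polynomial[OF G h finite_multi_idx, of B l c i]
    by (simp add: T_def z_def c_def Dmulti_zero multi_idx_def)
  moreover have fz: "integrable lborel (\<lambda>s. scaled_kernel g h s * f (z s))"
    unfolding z_def
    by (intro integrable_scaled_kernel_mult[OF G h] continuous_on_compose2[OF holder_ball_continuous[OF hol]])
       (use zV[unfolded z_def] in \<open>auto intro!: continuous_intros\<close>)
  ultimately have "(\<integral>s. scaled_kernel g h s * f (projB B (v + s *\<^sub>R axis i 1)) \<partial>lborel) - f (projB B v)
      = (\<integral>s. scaled_kernel g h s * (f (z s) - T s) \<partial>lborel)"
    by (simp add: pz t_def[symmetric] right_diff_distrib has_bochner_integral_iff)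
  also have "\<bar>\<dots>\<bar> \<le> (\<integral>s. \<bar>scaled_kernel g h s\<bar> * (L * h powr \<beta>) \<partial>lborel)"
  proof (rule abs_integral_bound)
    show "integrable lborel (\<lambda>s. \<bar>scaled_kernel g h s\<bar> * (L * h powr \<beta>))"
      using scaled_kernel_integrals(2)[OF G h] by (simp add: has_bochner_integral_iff)
    fix s
    show "\<bar>scaled_kernel g h s * (f (z s) - T s)\<bar> \<le> \<bar>scaled_kernel g h s\<bar> * (L * h powr \<beta>)"
    proof (cases "scaled_kernel g h s = 0")
      case False
      then have "\<bar>s\<bar> \<le> h" using scaled_kernel_eq_0[OF G h, of s] h by force
      moreover have "\<bar>f (z s) - T s\<bar> \<le> L * \<bar>s\<bar> powr \<beta>"
        using holder_ball_taylor[OF hol zV tV] by (simp add: T_def c_def l_def z_def)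
      moreover have "L * \<bar>s\<bar> powr \<beta> \<le> L * h powr \<beta>"
        using \<open>\<bar>s\<bar> \<le> h\<close> holder_ball_L_nonneg[OF hol] holder_ball_pos[OF hol]
        by (intro mult_left_mono powr_mono2) auto
      ultimately have "\<bar>f (z s) - T s\<bar> \<le> L * h powr \<beta>" by linarith
      then show ?thesis by (simp add: abs_mult mult_left_mono)
    qed simp
  qed
  also have "\<dots> = l1norm g * (L * h powr \<beta>)"
    using scaled_kernel_integrals(2)[OF G h] by (simp add: has_bochner_integral_iff)
  finally show ?thesis .
qed

subsection \<open>The kernel \<open>K\<^sub>\<theta>\<close> in the coordinates of \<open>E\<close>\<close>

definition block_kernels :: "(real \<Rightarrow> real) \<Rightarrow> 'n set \<Rightarrow> ('n \<Rightarrow> real) \<Rightarrow> 'n \<Rightarrow> real \<Rightarrow> real" where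
  "block_kernels g A h j = (if j \<in> A then scaled_kernel g (h j) else g)"

lemma block_kernels_facts:
  fixes h :: "'n::finite \<Rightarrow> real"
  assumes G: "assumption_G g ell" and hp: "\<And>j. 0 < h j"
  shows supported_block_kernels: "supported_kernels (max (1/2) (Max (range h))) (block_kernels g A h)"
    and integral_block_kernels: "(\<integral>s. block_kernels g A h j s \<partial>lborel) = 1"
    and integral_abs_block_kernels: "(\<integral>s. \<bar>block_kernels g A h j s\<bar> \<partial>lborel) = l1norm g"
proof -
  have hb: "has_bochner_integral lborel (block_kernels g A h j) 1" for j
    using scaled_kernel_integrals(1)[OF G hp, of 0 j] assumption_G_integrals(1)[OF G, of 0]
    by (simp add: block_kernels_def)
  have "block_kernels g A h j s = 0" if "max (1/2) (Max (range h)) < \<bar>s\<bar>" for j s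
  proof (cases "j \<in> A")
    case True
    have "h j \<le> Max (range h)" by simp
    then have "h j / 2 < \<bar>s\<bar>" using that hp[of j] by linarith
    then show ?thesis using scaled_kernel_eq_0[OF G hp] True by (simp add: block_kernels_def)
  next
    case False
    have "s \<notin> {-1/2..1/2}" using that by auto
    then show ?thesis using False assumption_G_zero[OF G] by (simp add: block_kernels_def)
  qed
  then show "supported_kernels (max (1/2) (Max (range h))) (block_kernels g A h)"
    using hb by (auto simp: supported_kernels_def has_bochner_integral_iff)
  show "(\<integral>s. block_kernels g A h j s \<partial>lborel) = 1"
    using hb by (simp add: has_bochner_integral_iff)
  show "(\<integral>s. \<bar>block_kernels g A h j s\<bar> \<partial>lborel) = l1norm g"
    using scaled_kernel_integrals(2)[OF G hp] assumption_G_integrals(2)[OF G]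
    by (simp add: block_kernels_def has_bochner_integral_iff)
qed

lemma Gih_eq_prod_block_kernels: "Gih g A h u = (\<Prod>j\<in>UNIV. block_kernels g A h j (u $ j))"
proof -
  have "(\<Prod>j\<in>UNIV. block_kernels g A h j (u $ j))
      = (\<Prod>j\<in>UNIV. if j \<in> A then scaled_kernel g (h j) (u $ j) else g (u $ j))"
    by (intro prod.cong) (auto simp: block_kernels_def)
  also have "\<dots> = (\<Prod>j\<in>UNIV \<inter> {j. j \<in> A}. scaled_kernel g (h j) (u $ j)) * (\<Prod>j\<in>UNIV \<inter> - {j. j \<in> A}. g (u $ j))"
    by (rule prod.If_cases) simp
  also have "\<dots> = Gih g A h u"
    by (simp add: Gih_def scaled_kernel_def Diff_eq)
  finally show ?thesis ..
qed

lemma G0_eq_prod_block_kernels: "G0 g u = (\<Prod>j\<in>UNIV. block_kernels g {} h j (u $ j))"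
  by (simp add: G0_def block_kernels_def)

lemma Ktheta_has_integral:
  fixes E :: "real^'n::finite^'n" and Q :: "real^'n \<Rightarrow> real"
  assumes G: "assumption_G g ell" and hp: "\<And>j. 0 < h j" and dE: "det E \<noteq> 0"
    and Q: "continuous_on UNIV Q"
  shows "((\<lambda>t. Ktheta g P E h (t - x) * Q (transpose E *v t)) has_integral
     (\<Sum>A\<in>P. smoothing UNIV (block_kernels g A h) Q (transpose E *v x))
       - (real (card P) - 1) * smoothing UNIV (block_kernels g {} h) Q (transpose E *v x)) UNIV"
proof -
  define y where "y = transpose E *v x"
  note kernel = has_bochner_integral_product_kernel[OF supported_block_kernels[where h=h, OF G hp] Q, where y=y]
  have "has_bochner_integral lborel (\<lambda>v. (\<Sum>A\<in>P. Gih g A h (v - y) * Q v)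
      - (real (card P) - 1) * (G0 g (v - y) * Q v))
      ((\<Sum>A\<in>P. smoothing UNIV (block_kernels g A h) Q y)
       - (real (card P) - 1) * smoothing UNIV (block_kernels g {} h) Q y)"
    unfolding Gih_eq_prod_block_kernels G0_eq_prod_block_kernels[where h=h]
    by (intro has_bochner_integral_diff has_bochner_integral_sum has_bochner_integral_mult_right kernel)
  moreover have "Ktheta g P E h (t - x) * Q (transpose E *v t)
      = \<bar>det (transpose E)\<bar> * ((\<Sum>A\<in>P. Gih g A h (transpose E *v t - y) * Q (transpose E *v t))
        - (real (card P) - 1) * (G0 g (transpose E *v t - y) * Q (transpose E *v t)))" for t
    by (simp add: Ktheta_def y_def det_transpose matrix_vector_mult_diff_distrib
        sum_distrib_left sum_distrib_right algebra_simps)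
  ultimately show ?thesis
    using has_integral_matrix_image[of "transpose E"] dE by (simp add: det_transpose y_def)
qed

lemma smoothing_block_kernels_restrict:
  assumes G: "assumption_G g ell" and hp: "\<And>j. 0 < h j" and Q: "continuous_on UNIV Q"
    and inv: "\<And>i v s. i \<notin> B \<Longrightarrow> Q (v + s *\<^sub>R axis i 1) = Q v"
  shows "smoothing UNIV (block_kernels g A h) Q y = smoothing B (block_kernels g (A \<inter> B) h) Q y"
proof -
  have "smoothing (B \<union> (UNIV - B)) (block_kernels g A h) Q y = smoothing B (block_kernels g A h) Q y"
    using supported_block_kernels[where h=h, OF G hp] integral_block_kernels[where h=h, OF G hp] inv
    by (intro smoothing_invariant_directions[OF _ Q]) auto
  also have "\<dots> = smoothing B (block_kernels g (A \<inter> B) h) Q y"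
    by (rule smoothing_cong) (auto simp: block_kernels_def)
  finally show ?thesis by (simp add: Un_Diff_cancel)
qed

lemma block_smoothing_collapse:
  assumes G: "assumption_G g ell" and hp: "\<And>j. 0 < h j" and Q: "continuous_on UNIV Q"
    and P: "disjoint P" "finite P" and B: "B \<in> P"
    and inv: "\<And>i v s. i \<notin> B \<Longrightarrow> Q (v + s *\<^sub>R axis i 1) = Q v"
  shows "(\<Sum>A\<in>P. smoothing UNIV (block_kernels g A h) Q y)
      - (real (card P) - 1) * smoothing UNIV (block_kernels g {} h) Q y
    = smoothing B (block_kernels g B h) Q y"
proof -
  note restrict = smoothing_block_kernels_restrict[where h=h and B=B and Q=Q, OF G hp Q inv]
  have "smoothing UNIV (block_kernels g A h) Q y = smoothing UNIV (block_kernels g {} h) Q y"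
    if "A \<in> P - {B}" for A
    using that P(1) B restrict[of A] restrict[of "{}"] by (simp add: disjointD)
  then have "(\<Sum>A\<in>P - {B}. smoothing UNIV (block_kernels g A h) Q y)
      = real (card P - 1) * smoothing UNIV (block_kernels g {} h) Q y"
    using B P(2) by simp
  moreover have "real (card P - 1) = real (card P) - 1"
    using B P(2) card_gt_0_iff by (metis Suc_leI empty_iff of_nat_diff of_nat_1 One_nat_def)
  ultimately show ?thesis
    using B P(2) restrict[of B] by (simp add: sum.remove)
qed

lemma smoothing_holder_bound:
  assumes G: "assumption_G g ell" and hp: "\<And>j. 0 < h j"
    and hol: "holder_ball B \<beta> L f" and ell: "nat \<lfloor>\<beta>\<rfloor> \<le> ell"
  shows "\<bar>smoothing B (block_kernels g B h) (\<lambda>v. f (projB B v)) y - f (projB B y)\<bar>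
           \<le> L * (l1norm g ^ card B * (\<Sum>j\<in>B. h j powr \<beta>))"
proof -
  have "continuous_on UNIV (\<lambda>v. f (projB B v))"
    by (rule continuous_on_compose2[OF holder_ball_continuous[OF hol] continuous_on_projB])
       (auto simp: projB_in_Vsub)
  moreover have "\<bar>(\<integral>s. block_kernels g B h i s * f (projB B (v + s *\<^sub>R axis i 1)) \<partial>lborel)
      - f (projB B v)\<bar> \<le> l1norm g * (L * h i powr \<beta>)" if "i \<in> B" for i v
    using scaled_kernel_holder_step[OF hol that hp G ell] that by (simp add: block_kernels_def)
  ultimately have "\<bar>smoothing B (block_kernels g B h) (\<lambda>v. f (projB B v)) y - f (projB B y)\<bar>
      \<le> l1norm g ^ card B * (\<Sum>i\<in>B. L * h i powr \<beta>)"
    using holder_ball_L_nonneg[OF hol]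
    by (intro smoothing_bound[OF supported_block_kernels[where h=h, OF G hp] _ _
          integral_abs_block_kernels[where h=h, OF G hp] one_le_l1norm[OF G]]) simp_all
  then show ?thesis by (simp add: sum_distrib_left mult_ac)
qed

lemma Ktheta_block_has_integral:
  fixes E :: "real^'n::finite^'n"
  assumes G: "assumption_G g ell" and hp: "\<And>j. 0 < h j" and dE: "det E \<noteq> 0"
    and P: "disjoint P" and B: "B \<in> P" and hol: "holder_ball B \<beta> L f"
  shows "((\<lambda>t. Ktheta g P E h (t - x) * f (projB B (transpose E *v t))) has_integral
      smoothing B (block_kernels g B h) (\<lambda>v. f (projB B v)) (transpose E *v x)) UNIV"
proof -
  have Q: "continuous_on UNIV (\<lambda>v. f (projB B v))"
    by (rule continuous_on_compose2[OF holder_ball_continuous[OF hol] continuous_on_projB])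
       (auto simp: projB_in_Vsub)
  show ?thesis
    using Ktheta_has_integral[where P=P and x=x, OF G hp dE Q]
      block_smoothing_collapse[where y="transpose E *v x", OF G hp Q P _ B]
    by (simp add: projB_add_axis)
qed

theorem lemma4:
  fixes P :: "'n::finite set set" and E :: "real^'n^'n"
    and \<eta> L \<beta> hmin hmax :: real and \<beta>i :: "'n set \<Rightarrow> real"
    and f :: "'n set \<Rightarrow> real^'n \<Rightarrow> real" and F :: "real^'n \<Rightarrow> real"
    and g :: "real \<Rightarrow> real" and h :: "'n \<Rightarrow> real"
  assumes part: "partition_on UNIV P"
    and eta: "\<eta> > 0" and unit: "\<forall>j. norm (column j E) = 1" and detE: "\<bar>det E\<bar> \<ge> \<eta>"
    and beta: "\<forall>A\<in>P. \<beta>i A / real (card A) = \<beta>"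
    and hol: "\<forall>A\<in>P. holder_ball A (\<beta>i A) L (f A)"
    and F: "F = (\<lambda>t. \<Sum>A\<in>P. f A (projE A E t))"
    and G: "assumption_G g (Max ((\<lambda>A. nat \<lfloor>\<beta>i A\<rfloor>) ` P))"
    and h: "0 < hmin" "hmin \<le> hmax" "\<forall>j. h j \<in> {hmin..hmax}"
  shows "\<forall>x\<in>D0. \<bar>bias g P E h F x\<bar>
           \<le> L * (\<Sum>A\<in>P. l1norm g ^ card A * (\<Sum>j\<in>A. h j powr \<beta>i A))"
proof
  fix x :: "real^'n"
  define y where "y = transpose E *v x"
  have dE: "det E \<noteq> 0" using detE eta by auto
  have hp: "\<And>j. 0 < h j" using h by (meson atLeastAtMost_iff less_le_trans)
  have disj: "disjoint P" using part by (simp add: partition_on_def)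
  have "((\<lambda>t. Ktheta g P E h (t - x) * F t) has_integral
      (\<Sum>B\<in>P. smoothing B (block_kernels g B h) (\<lambda>v. f B (projB B v)) y)) UNIV"
    unfolding F projE_eq_projB sum_distrib_left y_def
    by (intro has_integral_sum Ktheta_block_has_integral[OF G hp dE disj]) (use hol in auto)
  then have "bias g P E h F x
      = (\<Sum>B\<in>P. smoothing B (block_kernels g B h) (\<lambda>v. f B (projB B v)) y - f B (projB B y))"
    by (simp add: bias_def integral_unique F projE_eq_projB y_def sum_subtractf)
  also have "\<bar>\<dots>\<bar> \<le> (\<Sum>B\<in>P. L * (l1norm g ^ card B * (\<Sum>j\<in>B. h j powr \<beta>i B)))"
  proof (intro order_trans[OF sum_abs] sum_mono smoothing_holder_bound[OF G hp])
    fix B assume "B \<in> P"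
    then show "holder_ball B (\<beta>i B) L (f B)" "nat \<lfloor>\<beta>i B\<rfloor> \<le> Max ((\<lambda>A. nat \<lfloor>\<beta>i A\<rfloor>) ` P)"
      using hol by auto
  qed
  finally show "\<bar>bias g P E h F x\<bar> \<le> L * (\<Sum>A\<in>P. l1norm g ^ card A * (\<Sum>j\<in>A. h j powr \<beta>i A))"
    by (simp add: sum_distrib_left)
qed

end
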